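(* Let $W:(\mathbb{R}^2,0)\to(\mathbb{R}^3,0)$ be a Whitney umbrella in Bruce-West normal form with coefficients $a_{ij}$, $b_i$ (see context), let $m\ge 1$ be an integer, let $c_w(x)=\left(x^{2m}\sum_{i\ge 0}c_i x^i,\ x^m\right)$ with $c_i\in\mathbb{R}$, and let $\gamma=W\circ c_w$. Let $\{\boldsymbol{e},\boldsymbol{b},\boldsymbol{n}\}$ be the Darboux frame along $\gamma$ defined in the context. Then $\gamma$ is an $m$-approximational contour generator of $W$ by the direction $\boldsymbol{b}(0)$ if and only if $C=0$, where $$C=2c_0^2+b_3c_0-a_{02}^2.$$
   Context: All maps are smooth map-germs. A map-germ $(\mathbb{R}^2,0)\to(\mathbb{R}^3,0)$ is a Whitney umbrella if, up to diffeomorphism-germs fixing the origin in source and target, it is equal to $(u,v)\mapsto(u,uv,v^2)^T$. Bruce-West normal form: for a fixed integer $k\ge 3$, $$W(u,v)=\begin{pmatrix}u\\ uv+\sum_{i=3}^{k}\frac{b_i}{i!}v^i+O(u,v)^{k+1}\\ \sum_{r=2}^{k}\sum_{i+j=r}\frac{a_{ij}}{i!\,j!}u^iv^j+O(u,v)^{k+1}\end{pmatrix},$$ with $a_{ij},b_i\in\mathbb{R}$ and $a_{02}\neq 0$, where $O(u,v)^{k+1}$ denotes terms of degree at least $k+1$. The expression $\sum_{i\ge0}c_ix^i$ is understood as the Taylor expansion at $0$ of a smooth function-germ. Darboux frame: $\boldsymbol{n}(x)=\mathcal{N}(x)/|\mathcal{N}(x)|$ and $\boldsymbol{e}(x)=\mathcal{E}(x)/|\mathcal{E}(x)|$,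 where $\mathcal{N}$ and $\mathcal{E}$ are the smooth $\mathbb{R}^3$-valued germs, nonvanishing at $x=0$, determined by $(W_u\times W_v)\circ c_w(x)=x^m\mathcal{N}(x)$ and $\gamma'(x)=x^{2m-1}\mathcal{E}(x)$; and $\boldsymbol{b}(x)=\boldsymbol{n}(x)\times\boldsymbol{e}(x)$. For an integer $l\ge 0$ and $\boldsymbol{v}\in\mathbb{R}^3$, the curve $\gamma$ is called an $l$-approximational contour generator of $W$ by the direction $\boldsymbol{v}$ if $\langle j^{(l)}\boldsymbol{n}(0),\boldsymbol{v}\rangle=0$, where $j^{(l)}\boldsymbol{n}(0)$ is the $l$-jet at $x=0$ of the unit normal vector field $\boldsymbol{n}$ of $W$ along $\gamma$; that is, all Taylor coefficients of order at most $l$ at $x=0$ of the function $x\mapsto\langle\boldsymbol{n}(x),\boldsymbol{v}\rangle$ vanish. *)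

theory Defs
  imports "HOL-Analysis.Analysis"
begin

unbundle cross3_syntax

primrec Ck_on :: "nat \<Rightarrow> ('a::real_normed_vector \<Rightarrow> 'b::real_normed_vector) \<Rightarrow> 'a set \<Rightarrow> bool" where
  "Ck_on 0 f S \<longleftrightarrow> continuous_on S f"
| "Ck_on (Suc k) f S \<longleftrightarrow> (\<forall>x\<in>S. f differentiable (at x)) \<and>
     (\<forall>v. Ck_on k (\<lambda>x. frechet_derivative f (at x) v) S)"

text \<open>Map-germs at the origin are represented by total functions whose values away from the
  origin are irrelevant; identities of germs are stated with \<^term>\<open>eventually P (nhds 0)\<close>.\<close>

definition smooth_germ :: "('a::real_normed_vector \<Rightarrow> 'b::real_normed_vector) \<Rightarrow> bool" where
  "smooth_germ f \<longleftrightarrow> (\<exists>U. open U \<and> 0 \<in> U \<and> (\<forall>k. Ck_on k f U))"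

definition diffeo_germ :: "('a::real_normed_vector \<Rightarrow> 'a) \<Rightarrow> bool" where
  "diffeo_germ \<phi> \<longleftrightarrow> smooth_germ \<phi> \<and> \<phi> 0 = 0 \<and>
     (\<exists>\<psi>. smooth_germ \<psi> \<and> \<psi> 0 = 0 \<and>
       (\<forall>\<^sub>F p in nhds 0. \<psi> (\<phi> p) = p) \<and> (\<forall>\<^sub>F p in nhds 0. \<phi> (\<psi> p) = p))"

definition whitney_umbrella :: "(real^2 \<Rightarrow> real^3) \<Rightarrow> bool" where
  "whitney_umbrella W \<longleftrightarrow> smooth_germ W \<and> W 0 = 0 \<and>
     (\<exists>\<phi> \<psi>. diffeo_germ \<phi> \<and> diffeo_germ \<psi> \<and>
       (\<forall>\<^sub>F p in nhds 0. \<psi> (W (\<phi> p)) = vector [p$1, p$1 * p$2, (p$2)\<^sup>2]))"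

definition partial_deriv :: "2 \<Rightarrow> (real^2 \<Rightarrow> 'b::real_normed_vector) \<Rightarrow> real^2 \<Rightarrow> 'b" where
  "partial_deriv i f p = frechet_derivative f (at p) (axis i 1)"

text \<open>The terms \<open>O(u,v)\<^bsup>k+1\<^esup>\<close>: smooth germs whose Taylor expansion at the origin has only terms
  of degree at least \<open>k + 1\<close>.\<close>

definition terms_beyond :: "nat \<Rightarrow> (real^2 \<Rightarrow> real) \<Rightarrow> bool" where
  "terms_beyond k h \<longleftrightarrow> smooth_germ h \<and>
     (\<forall>i j. i + j \<le> k \<longrightarrow> ((partial_deriv 1 ^^ i) ((partial_deriv 2 ^^ j) h)) 0 = 0)"

definition bruce_west_normal_form ::
    "nat \<Rightarrow> (nat \<Rightarrow> nat \<Rightarrow> real) \<Rightarrow> (nat \<Rightarrow> real) \<Rightarrow> (real^2 \<Rightarrow> real^3) \<Rightarrow> bool" where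
  "bruce_west_normal_form k a b W \<longleftrightarrow> k \<ge> 3 \<and> a 0 2 \<noteq> 0 \<and>
     (\<exists>g h. terms_beyond k g \<and> terms_beyond k h \<and>
       (\<forall>\<^sub>F p in nhds 0. let u = p$1; v = p$2 in
          W p = vector
            [u,
             u * v + (\<Sum>i=3..k. b i / fact i * v ^ i) + g p,
             (\<Sum>r=2..k. \<Sum>i=0..r. a i (r - i) / (fact i * fact (r - i)) * u ^ i * v ^ (r - i))
               + h p]))"

definition taylor_coeff :: "(real \<Rightarrow> real) \<Rightarrow> nat \<Rightarrow> real" where
  "taylor_coeff f i = (deriv ^^ i) f 0 / fact i"

text \<open>The curve \<open>x \<mapsto> (x\<^bsup>2m\<^esup> \<Sum>c\<^sub>i x\<^sup>i, x\<^sup>m)\<close>, where \<open>f\<close> is a smooth germ with Taylor coefficients \<open>c\<^sub>i\<close>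
  (the series itself need not converge).\<close>

definition c_w :: "nat \<Rightarrow> (real \<Rightarrow> real) \<Rightarrow> real \<Rightarrow> real^2" where
  "c_w m f x = vector [x ^ (2 * m) * f x, x ^ m]"

definition unit_normal_along ::
    "(real^2 \<Rightarrow> real^3) \<Rightarrow> (real \<Rightarrow> real^2) \<Rightarrow> nat \<Rightarrow> (real \<Rightarrow> real^3) \<Rightarrow> bool" where
  "unit_normal_along W c m n \<longleftrightarrow>
     (\<exists>N. smooth_germ N \<and> N 0 \<noteq> 0 \<and>
       (\<forall>\<^sub>F x in nhds 0. partial_deriv 1 W (c x) \<times> partial_deriv 2 W (c x) = x ^ m *\<^sub>R N x) \<and>
       (\<forall>\<^sub>F x in nhds 0. n x = N x /\<^sub>R norm (N x)))"

definition unit_tangent_along ::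
    "(real^2 \<Rightarrow> real^3) \<Rightarrow> (real \<Rightarrow> real^2) \<Rightarrow> nat \<Rightarrow> (real \<Rightarrow> real^3) \<Rightarrow> bool" where
  "unit_tangent_along W c m e \<longleftrightarrow>
     (\<exists>E. smooth_germ E \<and> E 0 \<noteq> 0 \<and>
       (\<forall>\<^sub>F x in nhds 0. vector_derivative (W \<circ> c) (at x) = x ^ (2 * m - 1) *\<^sub>R E x) \<and>
       (\<forall>\<^sub>F x in nhds 0. e x = E x /\<^sub>R norm (E x)))"

text \<open>The germs \<open>N\<close> and \<open>E\<close> above, hence the frame \<open>{e, b, n}\<close>, are uniquely determined as germs
  by \<open>W\<close>, \<open>c\<close> and \<open>m\<close>.\<close>

definition darboux_frame ::
    "(real^2 \<Rightarrow> real^3) \<Rightarrow> (real \<Rightarrow> real^2) \<Rightarrow> nat \<Rightarrow>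
     (real \<Rightarrow> real^3) \<Rightarrow> (real \<Rightarrow> real^3) \<Rightarrow> (real \<Rightarrow> real^3) \<Rightarrow> bool" where
  "darboux_frame W c m e b n \<longleftrightarrow>
     unit_tangent_along W c m e \<and> unit_normal_along W c m n \<and> (\<forall>\<^sub>F x in nhds 0. b x = n x \<times> e x)"

text \<open>The curve is \<open>W \<circ> c\<close> and \<open>n\<close> is the unit normal of \<open>W\<close> along it.\<close>

definition approx_contour_generator ::
    "nat \<Rightarrow> (real^2 \<Rightarrow> real^3) \<Rightarrow> (real \<Rightarrow> real^2) \<Rightarrow> nat \<Rightarrow> (real \<Rightarrow> real^3) \<Rightarrow> real^3 \<Rightarrow> bool" where
  "approx_contour_generator l W c m n w \<longleftrightarrow>
     unit_normal_along W c m n \<and> (\<forall>j\<le>l. taylor_coeff (\<lambda>x. n x \<bullet> w) j = 0)"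

end

theory Submission
  imports Defs
begin

text \<open>
  Put \<open>t = x\<^sup>m\<close>, so that along the curve \<open>(u, v) = (t\<^sup>2 f(x), t)\<close>: the parameter \<open>u\<close> has weight two in \<open>t\<close>.
  Reading off the weighted leading terms of the normal form gives
  \<open>W\<^sub>u = (1, t, a\<^sub>1\<^sub>1 t) + \<dots>\<close> and \<open>W\<^sub>v = (0, (c\<^sub>0 + b\<^sub>3/2) t\<^sup>2, a\<^sub>0\<^sub>2 t) + \<dots>\<close>
  (\<open>bruce_west_along_curve\<close>). Dividing the cross product by \<open>t\<close> yields
  \<open>N = (a\<^sub>0\<^sub>2 t, - a\<^sub>0\<^sub>2, (c\<^sub>0 + b\<^sub>3/2) t) + \<dots>\<close> (\<open>bruce_west_normal_along_c_w\<close>), and the chain rule yields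
  \<open>E(0) = m (2 c\<^sub>0, 0, a\<^sub>0\<^sub>2)\<close> (\<open>bruce_west_tangent_along_c_w\<close>). Hence \<open>b(0)\<close> is a nonzero multiple of
  \<open>(a\<^sub>0\<^sub>2, 0, - 2 c\<^sub>0)\<close>, and
  \<open>\<langle>N(x), (a\<^sub>0\<^sub>2, 0, - 2 c\<^sub>0)\<rangle> = x\<^sup>m (a\<^sub>0\<^sub>2\<^sup>2 - 2 c\<^sub>0\<^sup>2 - b\<^sub>3 c\<^sub>0) + o(x\<^sup>m)\<close>.
  So \<open>\<langle>n(x), b(0)\<rangle> / x\<^sup>m\<close> tends to \<open>C\<close> times a nonzero constant.

  For a smooth germ \<open>\<phi>\<close> such that \<open>\<phi>(x) / x\<^sup>m\<close> converges, the Taylor coefficients of order below \<open>m\<close>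
  vanish and the one of order \<open>m\<close> is the limit (\<open>taylor_coeffs_vanish_iff\<close>); this concludes the proof
  once \<open>\<langle>n, b(0)\<rangle>\<close> is known to be smooth, which is where the calculus of \<open>Ck_on\<close> is used.

  Two points need care. The remainders in the normal form are only known through their partial
  derivatives at the origin, taken in one fixed order, so the estimate for \<open>W\<^sub>u\<close> requires the symmetry
  of second partial derivatives (\<open>partial_deriv_commute\<close>). And since \<open>\<langle>n, b(0)\<rangle>\<close> must be
  controlled to order \<open>m\<close> in \<open>x\<close>, that is to first order in \<open>t\<close>, the component \<open>W\<^sub>v $ 2\<close> is needed up to
  \<open>o(t\<^sup>2)\<close> (\<open>tendsto_along_curve_quadratic\<close>).
\<close>

section \<open>Products and norms of smooth maps\<close>

lemma Ck_on_subset: "Ck_on k f S \<Longrightarrow> T \<subseteq> S \<Longrightarrow> Ck_on k f T"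
  by (induction k arbitrary: f) (auto intro: continuous_on_subset)

lemma Ck_on_SucD: "Ck_on (Suc k) f S \<Longrightarrow> Ck_on k f S"
proof (induction k arbitrary: f)
  case 0
  then show ?case
    by (auto intro!: differentiable_imp_continuous_on differentiable_at_imp_differentiable_on)
next
  case (Suc k)
  show ?case
    unfolding Ck_on.simps(2)
  proof (intro conjI allI)
    show "\<forall>x\<in>S. f differentiable at x" using Suc.prems by simp
    fix v
    have "Ck_on (Suc k) (\<lambda>x. frechet_derivative f (at x) v) S"
      using Suc.prems by (subst (asm) Ck_on.simps(2)) blast
    then show "Ck_on k (\<lambda>x. frechet_derivative f (at x) v) S" by (rule Suc.IH)
  qed
qed

lemma Ck_on_cong:
  assumes "open S" "\<And>x. x \<in> S \<Longrightarrow> f x = g x" "Ck_on k f S"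
  shows "Ck_on k g S"
  using assms(2,3)
proof (induction k arbitrary: f g)
  case 0
  then show ?case using continuous_on_cong[of S S f g] by simp
next
  case (Suc k)
  have D: "(g has_derivative frechet_derivative f (at x)) (at x)" if "x \<in> S" for x
    using Suc.prems that assms(1)
    by (auto intro!: has_derivative_transform_within_open[of f _ x UNIV S g] simp: frechet_derivative_works)
  have "Ck_on k (\<lambda>x. frechet_derivative g (at x) v) S" for v
  proof (rule Suc.IH[of "\<lambda>x. frechet_derivative f (at x) v"])
    fix x assume "x \<in> S"
    from frechet_derivative_at[OF D[OF this]]
    show "frechet_derivative f (at x) v = frechet_derivative g (at x) v" by simp
  qed (use Suc.prems in simp)
  with D show ?case by (auto simp: differentiable_def)
qed

lemma Ck_on_SucI:
  assumes "open S" "\<And>x. x \<in> S \<Longrightarrow> (f has_derivative f' x) (at x)" "\<And>v. Ck_on k (\<lambda>x. f' x v) S"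
  shows "Ck_on (Suc k) f S"
  unfolding Ck_on.simps(2)
proof (intro conjI allI)
  show "\<forall>x\<in>S. f differentiable at x" using assms(2) by (auto simp: differentiable_def)
  show "Ck_on k (\<lambda>x. frechet_derivative f (at x) v) S" for v
    by (rule Ck_on_cong[OF assms(1) _ assms(3)[of v]]) (simp add: frechet_derivative_at[OF assms(2), symmetric])
qed

lemma Ck_on_const: "open S \<Longrightarrow> Ck_on k (\<lambda>x. c) S"
  by (induction k arbitrary: c) (auto intro!: Ck_on_SucI[where f'="\<lambda>x v. 0"])

lemma Ck_on_add:
  assumes "open S"
  shows "Ck_on k f S \<Longrightarrow> Ck_on k g S \<Longrightarrow> Ck_on k (\<lambda>x. f x + g x) S"
proof (induction k arbitrary: f g)
  case 0
  then show ?case by (auto intro: continuous_on_add)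
next
  case (Suc k)
  show ?case
  proof (rule Ck_on_SucI[OF assms])
    show "((\<lambda>x. f x + g x) has_derivative
        (\<lambda>v. frechet_derivative f (at x) v + frechet_derivative g (at x) v)) (at x)" if "x \<in> S" for x
      using Suc.prems that by (intro has_derivative_add) (auto simp: frechet_derivative_works)
  qed (use Suc in auto)
qed

text \<open>The derivative of a product is a sum of two products of \<open>C\<^sup>k\<close> maps, so one induction on the order of
  differentiability covers every bilinear product.\<close>
lemma (in bounded_bilinear) Ck_on_prod:
  assumes "open S"
  shows "Ck_on k f S \<Longrightarrow> Ck_on k g S \<Longrightarrow> Ck_on k (\<lambda>x. prod (f x) (g x)) S"
proof (induction k arbitrary: f g)
  case 0
  then show ?case by (auto intro: continuous_on)
next
  case (Suc k)
  show ?case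
  proof (rule Ck_on_SucI[OF assms])
    show "((\<lambda>x. prod (f x) (g x)) has_derivative
        (\<lambda>v. prod (f x) (frechet_derivative g (at x) v) + prod (frechet_derivative f (at x) v) (g x))) (at x)"
      if "x \<in> S" for x
      using Suc.prems that by (intro FDERIV) (auto simp: frechet_derivative_works)
    show "Ck_on k (\<lambda>x. prod (f x) (frechet_derivative g (at x) v) + prod (frechet_derivative f (at x) v) (g x)) S" for v
      using Suc.prems Suc.IH Ck_on_SucD[OF Suc.prems(1)] Ck_on_SucD[OF Suc.prems(2)]
      by (intro Ck_on_add[OF assms]) auto
  qed
qed

text \<open>The derivative of \<open>r = 1 / |f|\<close> is \<open>- r\<^sup>3 \<langle>f, Df\<rangle>\<close>, a polynomial in \<open>r\<close> itself, \<open>f\<close> and \<open>Df\<close>; hence an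
  induction on the order works without the composition rule for higher derivatives.\<close>
lemma Ck_on_inverse_norm:
  fixes f :: "'a::real_normed_vector \<Rightarrow> 'b::real_inner"
  assumes "open S" "\<And>x. x \<in> S \<Longrightarrow> f x \<noteq> 0"
  shows "Ck_on k f S \<Longrightarrow> Ck_on k (\<lambda>x. inverse (norm (f x))) S"
proof (induction k)
  case 0
  then show ?case using assms(2) by (auto intro!: continuous_on_inverse continuous_on_norm)
next
  case (Suc k)
  let ?r = "\<lambda>x. inverse (norm (f x))"
  have r: "Ck_on k ?r S" and f: "Ck_on k f S" and df: "Ck_on k (\<lambda>x. frechet_derivative f (at x) v) S" for v
    using Suc.IH Suc.prems Ck_on_SucD[OF Suc.prems] by auto
  show ?case
  proof (rule Ck_on_SucI[OF assms(1)])
    show "(?r has_derivative (\<lambda>v. - 1 * ((?r x * (?r x * ?r x)) * (f x \<bullet> frechet_derivative f (at x) v)))) (at x)"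
      if x: "x \<in> S" for x
    proof -
      let ?D = "frechet_derivative f (at x)"
      have "(f has_derivative ?D) (at x)"
        using Suc.prems x by (auto simp: frechet_derivative_works)
      then have "((\<lambda>x. norm (f x)) has_derivative (\<lambda>v. sgn (f x) \<bullet> ?D v)) (at x)"
        using has_derivative_compose[of f ?D x UNIV norm "\<lambda>h. h \<bullet> sgn (f x)"]
          has_derivative_norm[OF assms(2)[OF x]]
        by (simp add: inner_commute)
      from Deriv.has_derivative_inverse[OF _ this]
      show ?thesis
        using assms(2)[OF x] by (simp add: sgn_div_norm field_simps)
    qed
    show "Ck_on k (\<lambda>x. - 1 * ((?r x * (?r x * ?r x)) * (f x \<bullet> frechet_derivative f (at x) v))) S" for v
      by (intro bounded_bilinear.Ck_on_prod[OF bounded_bilinear_mult]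
          bounded_bilinear.Ck_on_prod[OF bounded_bilinear_inner] Ck_on_const assms r f df)
  qed
qed

section \<open>Smooth germs\<close>

lemma smooth_germ_cong:
  assumes "smooth_germ f" "\<forall>\<^sub>F x in nhds 0. f x = g x"
  shows "smooth_germ g"
proof -
  obtain U where U: "open U" "0 \<in> U" "\<And>k. Ck_on k f U"
    using assms(1) unfolding smooth_germ_def by auto
  obtain V where V: "open V" "0 \<in> V" "\<And>x. x \<in> V \<Longrightarrow> f x = g x"
    using assms(2) unfolding eventually_nhds by auto
  have "Ck_on k g (U \<inter> V)" for k
    by (rule Ck_on_cong[of _ f]) (use U V Ck_on_subset[OF U(3)] in auto)
  with U V show ?thesis unfolding smooth_germ_def by (intro exI[of _ "U \<inter> V"]) auto
qed

text \<open>Normalising is smooth on the neighbourhood of the origin where \<open>N\<close> does not vanish.\<close>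
lemma smooth_germ_unit_normal_component:
  fixes N :: "'a::real_normed_vector \<Rightarrow> 'b::real_inner"
  assumes "smooth_germ N" "N 0 \<noteq> 0"
  shows "smooth_germ (\<lambda>x. (N x /\<^sub>R norm (N x)) \<bullet> w)"
proof -
  obtain U where U: "open U" "0 \<in> U" "\<And>k. Ck_on k N U"
    using assms(1) unfolding smooth_germ_def by auto
  define V where "V = U \<inter> N -` (- {0})"
  have "continuous_on U N" using U(3)[of 0] by simp
  then have V: "open V" unfolding V_def using U(1) by (intro continuous_open_preimage) auto
  have N: "Ck_on k N V" for k using U(3) by (rule Ck_on_subset) (auto simp: V_def)
  have "Ck_on k (\<lambda>x. inverse (norm (N x)) * (N x \<bullet> w)) V" for k
    by (intro bounded_bilinear.Ck_on_prod[OF bounded_bilinear_mult]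
          bounded_bilinear.Ck_on_prod[OF bounded_bilinear_inner] Ck_on_const N Ck_on_inverse_norm V)
      (auto simp: V_def)
  then show ?thesis using V U(2) assms(2) unfolding smooth_germ_def
    by (intro exI[of _ V]) (auto simp: V_def)
qed

lemma smooth_germ_isCont: "smooth_germ f \<Longrightarrow> isCont f 0"
  unfolding smooth_germ_def by (metis Ck_on.simps(1) continuous_on_eq_continuous_at)

lemma smooth_germ_differentiable:
  "smooth_germ f \<Longrightarrow> \<forall>\<^sub>F x in nhds 0. f differentiable at x"
  unfolding smooth_germ_def eventually_nhds by (metis Ck_on.simps(2))

lemma smooth_germ_frechet_derivative:
  "smooth_germ f \<Longrightarrow> smooth_germ (\<lambda>x. frechet_derivative f (at x) v)"
  unfolding smooth_germ_def by (metis Ck_on.simps(2))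

lemma smooth_germ_partial_deriv: "smooth_germ f \<Longrightarrow> smooth_germ (partial_deriv i f)"
  unfolding partial_deriv_def[abs_def] by (rule smooth_germ_frechet_derivative)

lemma smooth_germ_deriv:
  fixes f :: "real \<Rightarrow> real"
  assumes "smooth_germ f"
  shows "smooth_germ (deriv f)"
proof (rule smooth_germ_cong[OF smooth_germ_frechet_derivative[OF assms, of 1]])
  show "\<forall>\<^sub>F x in nhds 0. frechet_derivative f (at x) 1 = deriv f x"
    using smooth_germ_differentiable[OF assms]
  proof eventually_elim
    case (elim x)
    then obtain D where D: "(f has_real_derivative D) (at x)"
      by (auto simp: real_differentiable_def)
    then show ?case
      using frechet_derivative_at[of f "(*) D" x] DERIV_imp_deriv[OF D]
      by (metis has_field_derivative_def mult.right_neutral)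
  qed
qed

lemma smooth_germ_higher_deriv:
  fixes f :: "real \<Rightarrow> real"
  shows "smooth_germ f \<Longrightarrow> smooth_germ ((deriv ^^ n) f)"
  by (induction n) (auto intro: smooth_germ_deriv)

lemma smooth_germ_has_real_derivative:
  fixes f :: "real \<Rightarrow> real"
  assumes "smooth_germ f"
  shows "\<forall>\<^sub>F x in nhds 0. (f has_real_derivative deriv f x) (at x)"
  using smooth_germ_differentiable[OF assms]
  by eventually_elim (metis DERIV_deriv_iff_real_differentiable)

section \<open>Taylor coefficients of germs of one variable\<close>

lemma eventually_nhds_0_abs:
  fixes P :: "real \<Rightarrow> bool"
  shows "eventually P (nhds 0) \<longleftrightarrow> (\<exists>d>0. \<forall>x. \<bar>x\<bar> < d \<longrightarrow> P x)"
  by (simp add: eventually_nhds_metric dist_real_def)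

text \<open>Mean value theorems produce an intermediate point for each \<open>x\<close> separately. Choosing them
  simultaneously turns such a statement into a limit that continuity can evaluate.\<close>
lemma tendsto_choose_small:
  fixes s :: "'a \<Rightarrow> real"
  assumes "\<forall>\<^sub>F x in F. \<exists>t. \<bar>t\<bar> \<le> \<bar>s x\<bar> \<and> P x t" "(s \<longlongrightarrow> 0) F"
  obtains t :: "'a \<Rightarrow> real" where "(t \<longlongrightarrow> 0) F" "\<forall>\<^sub>F x in F. P x (t x)"
proof -
  define t where "t x = (SOME t. \<bar>t\<bar> \<le> \<bar>s x\<bar> \<and> P x t)" for x
  have t: "\<forall>\<^sub>F x in F. \<bar>t x\<bar> \<le> \<bar>s x\<bar> \<and> P x (t x)"
    using assms(1) unfolding t_def by eventually_elim (rule someI_ex)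
  have "(t \<longlongrightarrow> 0) F"
    by (rule Lim_null_comparison[of _ "\<lambda>x. \<bar>s x\<bar>"])
      (use t assms(2) in \<open>auto elim: eventually_mono simp: tendsto_rabs_zero\<close>)
  moreover have "\<forall>\<^sub>F x in F. P x (t x)"
    using t by eventually_elim simp
  ultimately show ?thesis by (rule that)
qed

lemma taylor_quotient_tendsto:
  fixes f :: "real \<Rightarrow> real"
  assumes "smooth_germ f" "\<And>i. i < n \<Longrightarrow> taylor_coeff f i = 0"
  shows "((\<lambda>x. f x / x ^ n) \<longlongrightarrow> taylor_coeff f n) (at 0)"
proof -
  have "\<forall>\<^sub>F x in nhds 0. \<forall>i\<in>{..<n}. ((deriv ^^ i) f has_real_derivative (deriv ^^ Suc i) f x) (at x)"
    using smooth_germ_has_real_derivative[OF smooth_germ_higher_deriv[OF assms(1)]]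
    by (intro eventually_ball_finite) auto
  then obtain d where d: "d > 0"
    "\<And>x i. \<bar>x\<bar> < d \<Longrightarrow> i < n \<Longrightarrow> ((deriv ^^ i) f has_real_derivative (deriv ^^ Suc i) f x) (at x)"
    unfolding eventually_nhds_0_abs by auto
  have "\<exists>t. \<bar>t\<bar> \<le> \<bar>x\<bar> \<and> f x / x ^ n = (deriv ^^ n) f t / fact n" if "\<bar>x\<bar> < d" "x \<noteq> 0" for x
  proof -
    have "\<exists>t. \<bar>t\<bar> \<le> \<bar>x\<bar> \<and> f x = (\<Sum>m<n. (deriv ^^ m) f 0 / (fact m) * x ^ m) + (deriv ^^ n) f t / (fact n) * x ^ n"
      by (rule Maclaurin_bi_le) (use d that in auto)
    moreover have "(\<Sum>m<n. (deriv ^^ m) f 0 / (fact m) * x ^ m) = 0"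
      using assms(2) by (intro sum.neutral) (auto simp: taylor_coeff_def)
    ultimately show ?thesis using that by auto
  qed
  then have "\<forall>\<^sub>F x in at 0. \<exists>t. \<bar>t\<bar> \<le> \<bar>x\<bar> \<and> f x / x ^ n = (deriv ^^ n) f t / fact n"
    using d(1) by (auto simp: eventually_at dist_real_def)
  then obtain t where t: "(t \<longlongrightarrow> 0) (at 0)" "\<forall>\<^sub>F x in at 0. f x / x ^ n = (deriv ^^ n) f (t x) / fact n"
    by (rule tendsto_choose_small[OF _ tendsto_ident_at])
  have "((\<lambda>x. (deriv ^^ n) f (t x) / fact n) \<longlongrightarrow> taylor_coeff f n) (at 0)"
    unfolding taylor_coeff_def
    by (intro tendsto_intros isCont_tendsto_compose[OF smooth_germ_isCont t(1)] smooth_germ_higher_deriv assms) simp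
  then show ?thesis using t(2) by (simp add: tendsto_cong)
qed

text \<open>Below order \<open>m\<close> all coefficients vanish regardless of \<open>L\<close>: the first nonzero one, of order \<open>j < m\<close>, would be
  the limit of \<open>f(x) / x\<^sup>j = (f(x) / x\<^sup>m) x\<^bsup>m-j\<^esup>\<close>, which is zero. The coefficient of order \<open>m\<close> is then \<open>L\<close>.\<close>
lemma taylor_coeffs_vanish_iff:
  fixes f :: "real \<Rightarrow> real"
  assumes "smooth_germ f" and L: "((\<lambda>x. f x / x ^ m) \<longlongrightarrow> L) (at 0)"
  shows "(\<forall>j\<le>m. taylor_coeff f j = 0) \<longleftrightarrow> L = 0"
proof -
  have below: "taylor_coeff f j = 0" if "j < m" for j
    using that
  proof (induction j rule: less_induct)
    case (less j)
    have "((\<lambda>x. f x / x ^ m * x ^ (m - j)) \<longlongrightarrow> L * 0 ^ (m - j)) (at 0)"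
      by (intro tendsto_intros L)
    moreover have "\<forall>\<^sub>F x in at 0. f x / x ^ m * x ^ (m - j) = f x / x ^ j"
      unfolding eventually_at_filter
      using less.prems by (auto simp: field_simps power_add[symmetric])
    ultimately have "((\<lambda>x. f x / x ^ j) \<longlongrightarrow> 0) (at 0)"
      using less.prems by (simp add: tendsto_cong power_0_left)
    moreover have "((\<lambda>x. f x / x ^ j) \<longlongrightarrow> taylor_coeff f j) (at 0)"
      using less by (intro taylor_quotient_tendsto assms) auto
    ultimately show ?case by (metis LIM_unique)
  qed
  have "((\<lambda>x. f x / x ^ m) \<longlongrightarrow> taylor_coeff f m) (at 0)"
    using below by (intro taylor_quotient_tendsto assms) auto
  then have "taylor_coeff f m = L" using L by (rule LIM_unique)
  with below show ?thesis by (auto simp: le_less)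
qed

section \<open>Taylor expansion and symmetry of partial derivatives in the plane\<close>

lemma has_real_derivative_along_axis:
  fixes f :: "real^2 \<Rightarrow> real"
  assumes "f differentiable at (p + s *\<^sub>R axis i 1)"
  shows "((\<lambda>y. f (p + y *\<^sub>R axis i 1)) has_real_derivative partial_deriv i f (p + s *\<^sub>R axis i 1)) (at s)"
proof -
  let ?D = "frechet_derivative f (at (p + s *\<^sub>R axis i 1))"
  have D: "(f has_derivative ?D) (at (p + s *\<^sub>R axis i 1))"
    using assms by (simp add: frechet_derivative_works)
  have "((\<lambda>y. p + y *\<^sub>R axis i 1) has_derivative (\<lambda>y. y *\<^sub>R axis i 1)) (at s)"
    by (auto intro!: derivative_eq_intros)
  from has_derivative_compose[OF this D]
  have "((\<lambda>y. f (p + y *\<^sub>R axis i 1)) has_derivative (\<lambda>y. ?D (y *\<^sub>R axis i 1))) (at s)" .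
  moreover have "?D (y *\<^sub>R axis i 1) = partial_deriv i f (p + s *\<^sub>R axis i 1) * y" for y
    using linear_scale[OF has_derivative_linear[OF D]] by (simp add: partial_deriv_def mult.commute)
  ultimately show ?thesis by (simp add: has_field_derivative_def)
qed

lemma smooth_germ_higher_partial_deriv:
  "smooth_germ f \<Longrightarrow> smooth_germ ((partial_deriv i ^^ n) f)"
  by (induction n) (auto intro: smooth_germ_partial_deriv)

lemma norm_axis_segment_less:
  fixes p :: "real^2"
  assumes "norm p < d / 2" "\<bar>s\<bar> < d / 2" "\<bar>y\<bar> \<le> \<bar>s\<bar>"
  shows "norm (p + y *\<^sub>R axis i 1) < d"
proof -
  have "norm (p + y *\<^sub>R axis i 1) \<le> norm p + norm (y *\<^sub>R (axis i 1 :: real^2))"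
    by (rule norm_triangle_ineq)
  also have "\<dots> < d" using assms by simp
  finally show ?thesis .
qed

text \<open>Taylor's theorem with Lagrange remainder on the segments \<open>[p(x), p(x) + s(x) e\<^sub>i]\<close>, which shrink to the
  origin; the intermediate derivative is packaged as a function \<open>D\<close> with a known limit.\<close>
lemma taylor_along_axis:
  fixes f :: "real^2 \<Rightarrow> real"
  assumes f: "smooth_germ f" and p: "(p \<longlongrightarrow> 0) F" and s: "(s \<longlongrightarrow> 0) F"
  obtains D where "(D \<longlongrightarrow> (partial_deriv i ^^ n) f 0) F"
    "\<forall>\<^sub>F x in F. f (p x + s x *\<^sub>R axis i 1) =
       (\<Sum>j<n. (partial_deriv i ^^ j) f (p x) / fact j * s x ^ j) + D x / fact n * s x ^ n"
proof -
  have "\<forall>\<^sub>F q in nhds 0. \<forall>j\<in>{..<n}. (partial_deriv i ^^ j) f differentiable at q"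
    using smooth_germ_differentiable[OF smooth_germ_higher_partial_deriv[OF f]]
    by (intro eventually_ball_finite) auto
  then obtain d where d: "d > 0"
    "\<And>q j. norm q < d \<Longrightarrow> j < n \<Longrightarrow> (partial_deriv i ^^ j) f differentiable at q"
    unfolding eventually_nhds_metric by auto
  have ps: "\<forall>\<^sub>F x in F. norm (p x) < d / 2" "\<forall>\<^sub>F x in F. \<bar>s x\<bar> < d / 2"
    using tendstoD[OF p, of "d/2"] tendstoD[OF s, of "d/2"] d(1) by (auto simp: dist_norm)
  have "\<forall>\<^sub>F x in F. \<exists>t. \<bar>t\<bar> \<le> \<bar>s x\<bar> \<and> f (p x + s x *\<^sub>R axis i 1) =
     (\<Sum>j<n. (partial_deriv i ^^ j) f (p x) / fact j * s x ^ j) +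
     (partial_deriv i ^^ n) f (p x + t *\<^sub>R axis i 1) / fact n * s x ^ n"
    using ps
  proof eventually_elim
    case (elim x)
    have "((\<lambda>y. (partial_deriv i ^^ j) f (p x + y *\<^sub>R axis i 1)) has_real_derivative
        (partial_deriv i ^^ Suc j) f (p x + y *\<^sub>R axis i 1)) (at y)"
      if "j < n" "\<bar>y\<bar> \<le> \<bar>s x\<bar>" for j y
      using has_real_derivative_along_axis[OF d(2)[OF norm_axis_segment_less]] elim that
      by simp
    then show ?case
      using Maclaurin_bi_le[of "\<lambda>j y. (partial_deriv i ^^ j) f (p x + y *\<^sub>R axis i 1)"
          "\<lambda>y. f (p x + y *\<^sub>R axis i 1)" n "s x"] by simp
  qed
  then obtain t where t: "(t \<longlongrightarrow> 0) F" "\<forall>\<^sub>F x in F. f (p x + s x *\<^sub>R axis i 1) =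
     (\<Sum>j<n. (partial_deriv i ^^ j) f (p x) / fact j * s x ^ j) +
     (partial_deriv i ^^ n) f (p x + t x *\<^sub>R axis i 1) / fact n * s x ^ n"
    using s by (rule tendsto_choose_small)
  have "((\<lambda>x. p x + t x *\<^sub>R axis i 1) \<longlongrightarrow> 0 + 0 *\<^sub>R axis i 1) F"
    by (intro tendsto_add tendsto_scaleR tendsto_const p t(1))
  then have "((\<lambda>x. p x + t x *\<^sub>R axis i 1) \<longlongrightarrow> 0) F" by simp
  then have "((\<lambda>x. (partial_deriv i ^^ n) f (p x + t x *\<^sub>R axis i 1)) \<longlongrightarrow> (partial_deriv i ^^ n) f 0) F"
    by (rule isCont_tendsto_compose[OF smooth_germ_isCont[OF smooth_germ_higher_partial_deriv[OF f]]])
  with t(2) show ?thesis by (rule that[rotated])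
qed

text \<open>Two applications of the mean value theorem, first in direction \<open>i\<close> to the difference of \<open>f\<close> on the two
  opposite sides, then in direction \<open>j\<close>.\<close>
lemma rectangle_increment_tendsto:
  fixes f :: "real^2 \<Rightarrow> real"
  assumes f: "smooth_germ f"
  shows "((\<lambda>s. (f (s *\<^sub>R axis i 1 + s *\<^sub>R axis j 1) - f (s *\<^sub>R axis i 1) - f (s *\<^sub>R axis j 1) + f 0) / s\<^sup>2)
           \<longlongrightarrow> partial_deriv j (partial_deriv i f) 0) (at 0)"
proof -
  obtain d where d: "d > 0" "\<And>q. norm q < d \<Longrightarrow> f differentiable at q"
    using smooth_germ_differentiable[OF f] unfolding eventually_nhds_metric by auto
  let ?R = "\<lambda>s. f (s *\<^sub>R axis i 1 + s *\<^sub>R axis j 1) - f (s *\<^sub>R axis i 1) - f (s *\<^sub>R axis j 1) + f 0"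
  have "\<exists>t. \<bar>t\<bar> \<le> \<bar>s\<bar> \<and> ?R s =
      (partial_deriv i f (t *\<^sub>R axis i 1 + s *\<^sub>R axis j 1) - partial_deriv i f (t *\<^sub>R axis i 1)) * s"
    if s: "\<bar>s\<bar> < d / 2" for s
  proof -
    let ?q = "\<lambda>y. s *\<^sub>R axis j 1 + y *\<^sub>R axis i 1 :: real^2"
    let ?diff = "\<lambda>(n::nat) y. if n = 0 then f (?q y) - f (y *\<^sub>R axis i 1)
       else partial_deriv i f (?q y) - partial_deriv i f (y *\<^sub>R axis i 1)"
    have "((\<lambda>y. f (?q y) - f (y *\<^sub>R axis i 1)) has_real_derivative
        partial_deriv i f (?q y) - partial_deriv i f (y *\<^sub>R axis i 1)) (at y)"
      if y: "\<bar>y\<bar> \<le> \<bar>s\<bar>" for y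
    proof (rule DERIV_diff)
      show "((\<lambda>y. f (?q y)) has_real_derivative partial_deriv i f (?q y)) (at y)"
        by (rule has_real_derivative_along_axis[OF d(2)[OF norm_axis_segment_less[OF _ s y]]]) (use s in simp)
      show "((\<lambda>y. f (y *\<^sub>R axis i 1)) has_real_derivative partial_deriv i f (y *\<^sub>R axis i 1)) (at y)"
        using has_real_derivative_along_axis[of f 0 y i, OF d(2)[OF norm_axis_segment_less[OF _ s y]]] d(1) by simp
    qed
    \<comment> \<open>The Maclaurin formula of order one is a mean value theorem that covers both signs of \<open>s\<close>.\<close>
    then have "\<exists>t. \<bar>t\<bar> \<le> \<bar>s\<bar> \<and> ?diff 0 s = (\<Sum>m<1. ?diff m 0 / fact m * s ^ m) + ?diff 1 t / fact 1 * s ^ 1"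
      by (intro Maclaurin_bi_le) auto
    then show ?thesis by (auto simp: algebra_simps)
  qed
  then have "\<forall>\<^sub>F s in at 0. \<exists>t. \<bar>t\<bar> \<le> \<bar>s\<bar> \<and> ?R s =
      (partial_deriv i f (t *\<^sub>R axis i 1 + s *\<^sub>R axis j 1) - partial_deriv i f (t *\<^sub>R axis i 1)) * s"
    unfolding eventually_at dist_real_def
    by (intro exI[of _ "d / 2"]) (use d(1) in auto)
  then obtain t where t: "(t \<longlongrightarrow> 0) (at 0)" "\<forall>\<^sub>F s in at 0. ?R s =
      (partial_deriv i f (t s *\<^sub>R axis i 1 + s *\<^sub>R axis j 1) - partial_deriv i f (t s *\<^sub>R axis i 1)) * s"
    by (rule tendsto_choose_small[OF _ tendsto_ident_at])
  have "((\<lambda>s. t s *\<^sub>R axis i 1 :: real^2) \<longlongrightarrow> 0 *\<^sub>R axis i 1) (at 0)"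
    by (intro tendsto_intros t)
  then have p: "((\<lambda>s. t s *\<^sub>R axis i 1 :: real^2) \<longlongrightarrow> 0) (at 0)" by simp
  obtain D where D: "(D \<longlongrightarrow> (partial_deriv j ^^ 1) (partial_deriv i f) 0) (at 0)"
    "\<forall>\<^sub>F s in at 0. partial_deriv i f (t s *\<^sub>R axis i 1 + s *\<^sub>R axis j 1) =
       (\<Sum>n<1. (partial_deriv j ^^ n) (partial_deriv i f) (t s *\<^sub>R axis i 1) / fact n * s ^ n) + D s / fact 1 * s ^ 1"
    by (rule taylor_along_axis[OF smooth_germ_partial_deriv[OF f] p tendsto_ident_at])
  have "\<forall>\<^sub>F s in at 0. ?R s / s\<^sup>2 = D s"
    using t(2) D(2) eventually_neq_at_within[of 0 0 UNIV]
    by eventually_elim (simp add: power2_eq_square)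
  with D(1) show ?thesis by (simp add: tendsto_cong)
qed

text \<open>The increment over the square is symmetric in the two directions.\<close>
lemma partial_deriv_commute:
  fixes f :: "real^2 \<Rightarrow> real"
  assumes "smooth_germ f"
  shows "partial_deriv i (partial_deriv j f) 0 = partial_deriv j (partial_deriv i f) 0"
proof (rule LIM_unique[OF rectangle_increment_tendsto[OF assms]])
  show "((\<lambda>s. (f (s *\<^sub>R axis j 1 + s *\<^sub>R axis i 1) - f (s *\<^sub>R axis j 1) - f (s *\<^sub>R axis i 1) + f 0) / s\<^sup>2)
           \<longlongrightarrow> partial_deriv j (partial_deriv i f) 0) (at 0)"
    using rectangle_increment_tendsto[OF assms, of i j] by (simp add: algebra_simps)
qed

section \<open>Germs along curves tangent to the second axis\<close>

lemma vector_2_axis: "(vector [u, v] :: real^2) = v *\<^sub>R axis 2 1 + u *\<^sub>R axis 1 1"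
  by (simp add: vec_eq_iff forall_2 axis_def)

lemma tendsto_0_if_quotient_tendsto:
  fixes h v :: "'a \<Rightarrow> real"
  assumes "(v \<longlongrightarrow> 0) F" "\<forall>\<^sub>F x in F. v x \<noteq> 0" "((\<lambda>x. h x / v x) \<longlongrightarrow> l) F"
  shows "(h \<longlongrightarrow> 0) F"
proof -
  have "((\<lambda>x. h x / v x * v x) \<longlongrightarrow> l * 0) F" by (intro tendsto_intros assms)
  moreover have "\<forall>\<^sub>F x in F. h x / v x * v x = h x"
    using assms(2) by eventually_elim simp
  ultimately show ?thesis by (simp add: tendsto_cong)
qed
text \<open>The curve is tangent to the \<open>v\<close>-axis, so only \<open>\<partial>f/\<partial>v\<close> is seen to first order.\<close>
lemma tendsto_along_curve_linear:
  fixes f :: "real^2 \<Rightarrow> real"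
  assumes f: "smooth_germ f" "f 0 = 0" and v: "(v \<longlongrightarrow> 0) F" "\<forall>\<^sub>F x in F. v x \<noteq> 0"
    and u: "((\<lambda>x. u x / v x) \<longlongrightarrow> 0) F"
  shows "((\<lambda>x. f (vector [u x, v x]) / v x) \<longlongrightarrow> partial_deriv 2 f 0) F"
proof -
  have u0: "(u \<longlongrightarrow> 0) F" by (rule tendsto_0_if_quotient_tendsto[OF v u])
  have "((\<lambda>x. v x *\<^sub>R axis 2 1 :: real^2) \<longlongrightarrow> 0 *\<^sub>R axis 2 1) F" by (intro tendsto_intros v)
  then have p: "((\<lambda>x. v x *\<^sub>R axis 2 1 :: real^2) \<longlongrightarrow> 0) F" by simp
  obtain D1 where D1: "(D1 \<longlongrightarrow> (partial_deriv 1 ^^ 1) f 0) F"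
    "\<forall>\<^sub>F x in F. f (v x *\<^sub>R axis 2 1 + u x *\<^sub>R axis 1 1) =
     (\<Sum>j<1. (partial_deriv 1 ^^ j) f (v x *\<^sub>R axis 2 1) / fact j * u x ^ j) + D1 x / fact 1 * u x ^ 1"
    by (rule taylor_along_axis[OF f(1) p u0])
  obtain D2 where D2: "(D2 \<longlongrightarrow> (partial_deriv 2 ^^ 1) f 0) F"
    "\<forall>\<^sub>F x in F. f (0 + v x *\<^sub>R axis 2 1) =
     (\<Sum>j<1. (partial_deriv 2 ^^ j) f 0 / fact j * v x ^ j) + D2 x / fact 1 * v x ^ 1"
    by (rule taylor_along_axis[OF f(1) tendsto_const v(1)])
  have "\<forall>\<^sub>F x in F. f (vector [u x, v x]) / v x = D1 x * (u x / v x) + D2 x"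
    using D1(2) D2(2) v(2) by eventually_elim (simp add: vector_2_axis f(2) field_simps)
  moreover have "((\<lambda>x. D1 x * (u x / v x) + D2 x) \<longlongrightarrow> (partial_deriv 1 ^^ 1) f 0 * 0 + (partial_deriv 2 ^^ 1) f 0) F"
    by (intro tendsto_intros D1 D2 u)
  ultimately show ?thesis by (simp add: tendsto_cong)
qed

text \<open>With \<open>u\<close> of weight two, the terms of weight two are \<open>u \<partial>f/\<partial>u\<close> and \<open>(v\<^sup>2/2) \<partial>\<^sup>2f/\<partial>v\<^sup>2\<close>. The path from the
  origin first follows the \<open>v\<close>-axis, where a second order expansion is used, and then the direction
  of \<open>u\<close>, where a first order one suffices.\<close>
lemma tendsto_along_curve_quadratic:
  fixes f :: "real^2 \<Rightarrow> real"
  assumes f: "smooth_germ f" "f 0 = 0" "partial_deriv 2 f 0 = 0"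
    and v: "(v \<longlongrightarrow> 0) F" "\<forall>\<^sub>F x in F. v x \<noteq> 0"
    and u: "((\<lambda>x. u x / (v x)\<^sup>2) \<longlongrightarrow> c) F"
  shows "((\<lambda>x. f (vector [u x, v x]) / (v x)\<^sup>2)
           \<longlongrightarrow> c * partial_deriv 1 f 0 + partial_deriv 2 (partial_deriv 2 f) 0 / 2) F"
proof -
  have u0: "(u \<longlongrightarrow> 0) F"
    by (rule tendsto_0_if_quotient_tendsto[OF _ _ u]) (use tendsto_power[OF v(1), of 2] v(2) in auto)
  have "((\<lambda>x. v x *\<^sub>R axis 2 1 :: real^2) \<longlongrightarrow> 0 *\<^sub>R axis 2 1) F" by (intro tendsto_intros v)
  then have p: "((\<lambda>x. v x *\<^sub>R axis 2 1 :: real^2) \<longlongrightarrow> 0) F" by simp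
  obtain D1 where D1: "(D1 \<longlongrightarrow> (partial_deriv 1 ^^ 1) f 0) F"
    "\<forall>\<^sub>F x in F. f (v x *\<^sub>R axis 2 1 + u x *\<^sub>R axis 1 1) =
     (\<Sum>j<1. (partial_deriv 1 ^^ j) f (v x *\<^sub>R axis 2 1) / fact j * u x ^ j) + D1 x / fact 1 * u x ^ 1"
    by (rule taylor_along_axis[OF f(1) p u0])
  obtain D2 where D2: "(D2 \<longlongrightarrow> (partial_deriv 2 ^^ 2) f 0) F"
    "\<forall>\<^sub>F x in F. f (0 + v x *\<^sub>R axis 2 1) =
     (\<Sum>j<2. (partial_deriv 2 ^^ j) f 0 / fact j * v x ^ j) + D2 x / fact 2 * v x ^ 2"
    by (rule taylor_along_axis[OF f(1) tendsto_const v(1)])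
  have "\<forall>\<^sub>F x in F. f (vector [u x, v x]) / (v x)\<^sup>2 = u x / (v x)\<^sup>2 * D1 x + D2 x / 2"
    using D1(2) D2(2) v(2)
    by eventually_elim (simp add: vector_2_axis f(2,3) numeral_2_eq_2 field_simps)
  moreover have "((\<lambda>x. u x / (v x)\<^sup>2 * D1 x + D2 x / 2) \<longlongrightarrow>
      c * (partial_deriv 1 ^^ 1) f 0 + (partial_deriv 2 ^^ 2) f 0 / 2) F"
    by (intro tendsto_intros D1 D2 u) simp
  ultimately show ?thesis by (simp add: tendsto_cong numeral_2_eq_2)
qed

section \<open>Partial derivatives of the normal form along such curves\<close>

lemma vector_3_axis:
  "(vector [x, y, z] :: real^3) = x *\<^sub>R axis 1 1 + y *\<^sub>R axis 2 1 + z *\<^sub>R axis 3 1"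
  by (simp add: vec_eq_iff forall_3 axis_def)

lemma has_derivative_vector_3:
  fixes f1 f2 f3 :: "'a::real_normed_vector \<Rightarrow> real"
  assumes "(f1 has_derivative f1') F" "(f2 has_derivative f2') F" "(f3 has_derivative f3') F"
  shows "((\<lambda>p. vector [f1 p, f2 p, f3 p] :: real^3) has_derivative
           (\<lambda>w. vector [f1' w, f2' w, f3' w])) F"
  unfolding vector_3_axis by (auto intro!: derivative_eq_intros assms)

text \<open>Partial derivatives of the polynomial parts of the second and third components of the normal
  form. The derivative of the second component in \<open>u\<close> is just \<open>v\<close>.\<close>
definition second_poly_v :: "nat \<Rightarrow> (nat \<Rightarrow> real) \<Rightarrow> real \<Rightarrow> real \<Rightarrow> real" where
  "second_poly_v k b u v = u + (\<Sum>i=3..k. b i / fact i * (of_nat i * v ^ (i - 1)))"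

definition third_poly_u :: "nat \<Rightarrow> (nat \<Rightarrow> nat \<Rightarrow> real) \<Rightarrow> real \<Rightarrow> real \<Rightarrow> real" where
  "third_poly_u k a u v = (\<Sum>r=2..k. \<Sum>i=0..r. a i (r - i) / (fact i * fact (r - i)) *
     (of_nat i * u ^ (i - 1) * v ^ (r - i)))"

definition third_poly_v :: "nat \<Rightarrow> (nat \<Rightarrow> nat \<Rightarrow> real) \<Rightarrow> real \<Rightarrow> real \<Rightarrow> real" where
  "third_poly_v k a u v = (\<Sum>r=2..k. \<Sum>i=0..r. a i (r - i) / (fact i * fact (r - i)) *
     (u ^ i * (of_nat (r - i) * v ^ (r - i - 1))))"
lemma bruce_west_partial_derivs:
  assumes "bruce_west_normal_form k a b W"
  obtains g h where "terms_beyond k g" "terms_beyond k h"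
    "\<forall>\<^sub>F p in nhds 0. W differentiable at p \<and>
       partial_deriv 1 W p = vector
         [1, p$2 + partial_deriv 1 g p, third_poly_u k a (p$1) (p$2) + partial_deriv 1 h p] \<and>
       partial_deriv 2 W p = vector
         [0, second_poly_v k b (p$1) (p$2) + partial_deriv 2 g p, third_poly_v k a (p$1) (p$2) + partial_deriv 2 h p]"
proof -
  let ?f2 = "\<lambda>g p. p$1 * p$2 + (\<Sum>i=3..k. b i / fact i * (p$2) ^ i) + g p :: real"
  let ?f3 = "\<lambda>h p. (\<Sum>r=2..k. \<Sum>i=0..r. a i (r - i) / (fact i * fact (r - i)) * ((p$1) ^ i * (p$2) ^ (r - i)))
               + h p :: real"
  let ?F = "\<lambda>g h p. vector [p$1, ?f2 g p, ?f3 h p] :: real^3"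
  from assms obtain g h where gh: "terms_beyond k g" "terms_beyond k h" "\<forall>\<^sub>F p in nhds 0. W p = ?F g h p"
    unfolding bruce_west_normal_form_def by (auto simp: Let_def mult.assoc)
  have diff: "\<forall>\<^sub>F p in nhds 0. g differentiable at p" "\<forall>\<^sub>F p in nhds 0. h differentiable at p"
    using gh(1,2) by (auto simp: terms_beyond_def intro: smooth_germ_differentiable)
  have W: "\<forall>\<^sub>F p in nhds 0. \<forall>\<^sub>F q in nhds p. W q = ?F g h q"
    using gh(3) by (simp add: eventually_eventually)
  show ?thesis
  proof (rule that[OF gh(1,2)])
    show "\<forall>\<^sub>F p in nhds 0. W differentiable at p \<and>
       partial_deriv 1 W p = vector
         [1, p$2 + partial_deriv 1 g p, third_poly_u k a (p$1) (p$2) + partial_deriv 1 h p] \<and>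
       partial_deriv 2 W p = vector
         [0, second_poly_v k b (p$1) (p$2) + partial_deriv 2 g p, third_poly_v k a (p$1) (p$2) + partial_deriv 2 h p]"
      using diff W
    proof eventually_elim
      case (elim p)
      let ?f2' = "\<lambda>w. w$1 * p$2 + p$1 * w$2
        + (\<Sum>i=3..k. b i / fact i * (of_nat i * w$2 * (p$2) ^ (i - 1))) + frechet_derivative g (at p) w"
      let ?f3' = "\<lambda>w. (\<Sum>r=2..k. \<Sum>i=0..r. a i (r - i) / (fact i * fact (r - i)) *
          ((p$1) ^ i * (of_nat (r - i) * w$2 * (p$2) ^ (r - i - 1)) +
           of_nat i * w$1 * (p$1) ^ (i - 1) * (p$2) ^ (r - i)))
        + frechet_derivative h (at p) w"
      have coord: "((\<lambda>p. p $ i) has_derivative (\<lambda>w. w $ i)) (at p)" for i and p :: "real^2"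
        by (rule bounded_linear_imp_has_derivative[OF bounded_linear_vec_nth])
      have "(?F g h has_derivative (\<lambda>w. vector [w$1, ?f2' w, ?f3' w])) (at p)"
      proof (rule has_derivative_vector_3)
        show "((\<lambda>p. p$1) has_derivative (\<lambda>w. w$1)) (at p)" by (rule coord)
        show "(?f2 g has_derivative ?f2') (at p)"
          using elim(1) unfolding frechet_derivative_works
          by (auto intro!: derivative_eq_intros coord has_derivative_sum simp: algebra_simps)
        show "(?f3 h has_derivative ?f3') (at p)"
          using elim(2) unfolding frechet_derivative_works
          by (intro has_derivative_add has_derivative_sum has_derivative_mult_right has_derivative_mult
              has_derivative_power coord)
      qed
      moreover from elim(3) have "\<forall>\<^sub>F q in at p. ?F g h q = W q"
        by (auto simp: eventually_nhds_conv_at elim: eventually_mono)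
      moreover have "?F g h p = W p"
        using eventually_nhds_x_imp_x[OF elim(3)] by simp
      ultimately have D: "(W has_derivative (\<lambda>w. vector [w$1, ?f2' w, ?f3' w])) (at p)"
        by (auto intro: has_derivative_transform_eventually)
      show ?case
        using D by (auto simp: second_poly_v_def third_poly_u_def third_poly_v_def partial_deriv_def frechet_derivative_at[OF D, symmetric] differentiable_def axis_def)
    qed
  qed
qed

lemma power_diff_tendsto:
  fixes v :: "'a \<Rightarrow> real"
  assumes "(v \<longlongrightarrow> 0) F" "\<forall>\<^sub>F x in F. v x \<noteq> 0" "n \<ge> l"
  shows "((\<lambda>x. v x ^ n / v x ^ l) \<longlongrightarrow> (if n = l then 1 else 0)) F"
proof -
  have "\<forall>\<^sub>F x in F. v x ^ n / v x ^ l = v x ^ (n - l)"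
    using assms(2) by eventually_elim (simp add: assms(3) power_diff)
  moreover have "((\<lambda>x. v x ^ (n - l)) \<longlongrightarrow> 0 ^ (n - l)) F" by (intro tendsto_intros assms)
  ultimately show ?thesis using assms(3) by (simp add: tendsto_cong power_0_left)
qed

text \<open>In the following, \<open>(u, v)\<close> is a curve approaching the origin like the parabola \<open>u = c v\<^sup>2\<close>.\<close>

context
  fixes F :: "'a filter" and u v :: "'a \<Rightarrow> real" and c :: real
  assumes v: "(v \<longlongrightarrow> 0) F" "\<forall>\<^sub>F x in F. v x \<noteq> 0"
    and u: "((\<lambda>x. u x / (v x)\<^sup>2) \<longlongrightarrow> c) F"
begin

lemma curve_quotient_tendsto_0: "((\<lambda>x. u x / v x) \<longlongrightarrow> 0) F"
  by (rule tendsto_0_if_quotient_tendsto[OF v]) (use u in \<open>simp add: power2_eq_square\<close>)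

lemma curve_tendsto_0: "(u \<longlongrightarrow> 0) F"
  by (rule tendsto_0_if_quotient_tendsto[OF v curve_quotient_tendsto_0])

text \<open>A factor \<open>u\<close> has weight two, so the quotient by \<open>v\<close> still has positive weight.\<close>
lemma monomial_quotient_tendsto_0:
  assumes "i \<ge> 1"
  shows "((\<lambda>x. u x ^ i * v x ^ j / v x) \<longlongrightarrow> 0) F"
proof -
  have "((\<lambda>x. u x / v x * u x ^ (i - 1) * v x ^ j) \<longlongrightarrow> 0 * 0 ^ (i - 1) * 0 ^ j) F"
    by (intro tendsto_intros curve_quotient_tendsto_0 curve_tendsto_0 v)
  moreover have "u x / v x * u x ^ (i - 1) * v x ^ j = u x ^ i * v x ^ j / v x" for x
    using assms by (cases i) auto
  ultimately show ?thesis by (simp only: mult_zero_left)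
qed

lemma monomial_deriv_1_tendsto:
  assumes "r \<ge> 2" "i \<le> r"
  shows "((\<lambda>x. of_nat i * u x ^ (i - 1) * v x ^ (r - i) / v x)
            \<longlongrightarrow> (if i = 1 then if r = 2 then 1 else 0 else 0)) F"
proof -
  consider "i = 0" | "i = 1" | "i \<ge> 2" by linarith
  then show ?thesis
  proof cases
    case 1
    then show ?thesis by simp
  next
    case 2
    have "1 \<le> r - 1" "r - 1 = 1 \<longleftrightarrow> r = 2" using assms by auto
    with 2 show ?thesis using power_diff_tendsto[OF v, of 1 "r - 1"] by simp
  next
    case 3
    then show ?thesis
      using tendsto_mult_right_zero[OF monomial_quotient_tendsto_0[of "i - 1" "r - i"], of "of_nat i"]
      by (simp add: mult.assoc)
  qed
qed

lemma monomial_deriv_2_tendsto: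
  assumes "r \<ge> 2" "i \<le> r"
  shows "((\<lambda>x. u x ^ i * (of_nat (r - i) * v x ^ (r - i - 1)) / v x)
            \<longlongrightarrow> (if i = 0 then if r = 2 then 2 else 0 else 0)) F"
proof (cases "i = 0")
  case True
  have "((\<lambda>x. of_nat r * (v x ^ (r - 1) / v x ^ 1)) \<longlongrightarrow> of_nat r * (if r - 1 = 1 then 1 else 0)) F"
    by (intro tendsto_intros power_diff_tendsto v) (use assms in auto)
  moreover have "of_nat r * (if r - 1 = 1 then 1 else 0) = (if r = 2 then 2 else 0 :: real)"
    using assms by auto
  ultimately show ?thesis using True by (simp only: diff_zero power_0 mult_1 power_one_right times_divide_eq_right simp_thms if_True)
next
  case False
  then show ?thesis
    using tendsto_mult_right_zero[OF monomial_quotient_tendsto_0[of i "r - i - 1"], of "of_nat (r - i)"]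
    by (simp add: ac_simps)
qed

text \<open>The limits below are the coefficients of the leading weighted terms of \<open>W\<^sub>u\<close> and \<open>W\<^sub>v\<close>. Each derivative
  of a remainder term is negligible, by the two estimates along curves; each monomial of the polynomial
  part has a limit, nonzero for at most one of them.\<close>
lemma bruce_west_along_curve:
  assumes W: "bruce_west_normal_form k a b W"
  defines "p \<equiv> \<lambda>x. vector [u x, v x] :: real^2"
  shows "\<forall>\<^sub>F x in F. W differentiable at (p x)"
    and "\<forall>\<^sub>F x in F. partial_deriv 1 W (p x) $ 1 = 1"
    and "((\<lambda>x. partial_deriv 1 W (p x) $ 2 / v x) \<longlongrightarrow> 1) F"
    and "((\<lambda>x. partial_deriv 1 W (p x) $ 3 / v x) \<longlongrightarrow> a 1 1) F"
    and "\<forall>\<^sub>F x in F. partial_deriv 2 W (p x) $ 1 = 0"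
    and "((\<lambda>x. partial_deriv 2 W (p x) $ 2 / (v x)\<^sup>2) \<longlongrightarrow> c + b 3 / 2) F"
    and "((\<lambda>x. partial_deriv 2 W (p x) $ 3 / v x) \<longlongrightarrow> a 0 2) F"
proof -
  have k: "k \<ge> 3" using W by (simp add: bruce_west_normal_form_def)
  obtain g h where gh: "terms_beyond k g" "terms_beyond k h" and
    ev: "\<forall>\<^sub>F p in nhds 0. W differentiable at p \<and>
       partial_deriv 1 W p = vector
         [1, p$2 + partial_deriv 1 g p, third_poly_u k a (p$1) (p$2) + partial_deriv 1 h p] \<and>
       partial_deriv 2 W p = vector
         [0, second_poly_v k b (p$1) (p$2) + partial_deriv 2 g p, third_poly_v k a (p$1) (p$2) + partial_deriv 2 h p]"
    by (rule bruce_west_partial_derivs[OF W])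
  have "((\<lambda>x. v x *\<^sub>R axis 2 1 + u x *\<^sub>R axis 1 1 :: real^2) \<longlongrightarrow> 0 *\<^sub>R axis 2 1 + 0 *\<^sub>R axis 1 1) F"
    by (intro tendsto_intros curve_tendsto_0 v)
  then have "(p \<longlongrightarrow> 0) F" by (simp add: p_def vector_2_axis)
  from eventually_compose_filterlim[OF ev this]
  have ev: "\<forall>\<^sub>F x in F. W differentiable at (p x) \<and>
       partial_deriv 1 W (p x) = vector
         [1, v x + partial_deriv 1 g (p x), third_poly_u k a (u x) (v x) + partial_deriv 1 h (p x)] \<and>
       partial_deriv 2 W (p x) = vector
         [0, second_poly_v k b (u x) (v x) + partial_deriv 2 g (p x), third_poly_v k a (u x) (v x) + partial_deriv 2 h (p x)]"
    by (simp add: p_def)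
  show "\<forall>\<^sub>F x in F. W differentiable at (p x)" "\<forall>\<^sub>F x in F. partial_deriv 1 W (p x) $ 1 = 1"
    "\<forall>\<^sub>F x in F. partial_deriv 2 W (p x) $ 1 = 0"
    using ev by (auto elim: eventually_mono)

  have zero: "(partial_deriv 1 ^^ i) ((partial_deriv 2 ^^ j) f) 0 = 0"
    if "terms_beyond k f" "i + j \<le> 3" for f i j
    using that k by (auto simp: terms_beyond_def)
  \<comment> \<open>For \<open>i = 1\<close> the derivatives come in the order \<open>\<partial>\<^sub>2\<partial>\<^sub>1\<close>, opposite to the one in the remainder condition.\<close>
  have lin: "((\<lambda>x. partial_deriv i f (p x) / v x) \<longlongrightarrow> 0) F" if f: "terms_beyond k f" for i f
  proof -
    have sm: "smooth_germ f" using f by (simp add: terms_beyond_def)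
    have "partial_deriv i f 0 = 0" "partial_deriv 2 (partial_deriv i f) 0 = 0"
      using zero[OF f, of 1 0] zero[OF f, of 0 1] zero[OF f, of 0 2] zero[OF f, of 1 1]
        exhaust_2[of i] partial_deriv_commute[OF sm, of 2 1]
      by (auto simp: numeral_2_eq_2)
    then show ?thesis
      using tendsto_along_curve_linear[OF smooth_germ_partial_deriv[OF sm] _ v curve_quotient_tendsto_0, of i]
      by (simp add: p_def)
  qed
  \<comment> \<open>This is the place where third derivatives of the remainder must vanish, hence \<open>k \<ge> 3\<close>.\<close>
  have quad: "((\<lambda>x. partial_deriv 2 g (p x) / (v x)\<^sup>2) \<longlongrightarrow> 0) F"
    using tendsto_along_curve_quadratic[OF smooth_germ_partial_deriv _ _ v u, of g 2] gh(1)
      zero[OF gh(1), of 0 1] zero[OF gh(1), of 0 2] zero[OF gh(1), of 1 1] zero[OF gh(1), of 0 3]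
    by (simp add: p_def terms_beyond_def numeral_2_eq_2 numeral_3_eq_3)

  have "\<forall>\<^sub>F x in F. partial_deriv 1 W (p x) $ 2 / v x = 1 + partial_deriv 1 g (p x) / v x"
    using ev v(2) by eventually_elim (simp add: field_simps)
  moreover have "((\<lambda>x. 1 + partial_deriv 1 g (p x) / v x) \<longlongrightarrow> 1 + 0) F"
    by (intro tendsto_intros lin gh)
  ultimately show "((\<lambda>x. partial_deriv 1 W (p x) $ 2 / v x) \<longlongrightarrow> 1) F"
    by (simp add: tendsto_cong)

  have "\<forall>\<^sub>F x in F. partial_deriv 1 W (p x) $ 3 / v x =
      (\<Sum>r=2..k. \<Sum>i=0..r. a i (r - i) / (fact i * fact (r - i)) *
         (of_nat i * (u x) ^ (i - 1) * (v x) ^ (r - i) / v x)) + partial_deriv 1 h (p x) / v x"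
    using ev by eventually_elim (simp add: third_poly_u_def add_divide_distrib sum_divide_distrib)
  moreover have "((\<lambda>x. (\<Sum>r=2..k. \<Sum>i=0..r. a i (r - i) / (fact i * fact (r - i)) *
         (of_nat i * (u x) ^ (i - 1) * (v x) ^ (r - i) / v x)) + partial_deriv 1 h (p x) / v x) \<longlongrightarrow>
      (\<Sum>r=2..k. \<Sum>i=0..r. a i (r - i) / (fact i * fact (r - i)) *
         (if i = 1 then if r = 2 then 1 else 0 else 0)) + 0) F"
    by (intro tendsto_add tendsto_sum tendsto_mult tendsto_const monomial_deriv_1_tendsto lin gh) auto
  moreover have "(\<Sum>r=2..k. \<Sum>i=0..r. a i (r - i) / (fact i * fact (r - i)) *
         (if i = 1 then if r = 2 then 1 else 0 else 0)) = (\<Sum>r=2..k. if r = 2 then a 1 1 else 0)"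
    by (intro sum.cong refl) (auto simp: numeral_2_eq_2)
  ultimately show "((\<lambda>x. partial_deriv 1 W (p x) $ 3 / v x) \<longlongrightarrow> a 1 1) F"
    using k by (simp add: tendsto_cong)

  have "\<forall>\<^sub>F x in F. partial_deriv 2 W (p x) $ 3 / v x =
      (\<Sum>r=2..k. \<Sum>i=0..r. a i (r - i) / (fact i * fact (r - i)) *
         ((u x) ^ i * (of_nat (r - i) * (v x) ^ (r - i - 1)) / v x)) + partial_deriv 2 h (p x) / v x"
    using ev by eventually_elim (simp add: third_poly_v_def add_divide_distrib sum_divide_distrib)
  moreover have "((\<lambda>x. (\<Sum>r=2..k. \<Sum>i=0..r. a i (r - i) / (fact i * fact (r - i)) *
         ((u x) ^ i * (of_nat (r - i) * (v x) ^ (r - i - 1)) / v x)) + partial_deriv 2 h (p x) / v x) \<longlongrightarrow>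
      (\<Sum>r=2..k. \<Sum>i=0..r. a i (r - i) / (fact i * fact (r - i)) *
         (if i = 0 then if r = 2 then 2 else 0 else 0)) + 0) F"
    by (intro tendsto_add tendsto_sum tendsto_mult tendsto_const monomial_deriv_2_tendsto lin gh) auto
  moreover have "(\<Sum>r=2..k. \<Sum>i=0..r. a i (r - i) / (fact i * fact (r - i)) *
         (if i = 0 then if r = 2 then 2 else 0 else 0)) = (\<Sum>r=2..k. if r = 2 then a 0 2 else 0)"
    by (intro sum.cong refl) (auto simp: numeral_2_eq_2)
  ultimately show "((\<lambda>x. partial_deriv 2 W (p x) $ 3 / v x) \<longlongrightarrow> a 0 2) F"
    using k by (simp add: tendsto_cong)

  have "\<forall>\<^sub>F x in F. partial_deriv 2 W (p x) $ 2 / (v x)\<^sup>2 =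
      u x / (v x)\<^sup>2 + (\<Sum>i=3..k. b i / fact i * (of_nat i * (v x ^ (i - 1) / v x ^ 2)))
        + partial_deriv 2 g (p x) / (v x)\<^sup>2"
    using ev by eventually_elim (simp add: second_poly_v_def add_divide_distrib sum_divide_distrib)
  moreover have "((\<lambda>x. u x / (v x)\<^sup>2 + (\<Sum>i=3..k. b i / fact i * (of_nat i * (v x ^ (i - 1) / v x ^ 2)))
        + partial_deriv 2 g (p x) / (v x)\<^sup>2) \<longlongrightarrow>
      c + (\<Sum>i=3..k. b i / fact i * (of_nat i * (if i - 1 = 2 then 1 else 0))) + 0) F"
    by (intro tendsto_add tendsto_sum tendsto_mult tendsto_const power_diff_tendsto u v quad) auto
  moreover have "(\<Sum>i=3..k. b i / fact i * (of_nat i * (if i - 1 = 2 then 1 else 0))) = b 3 / 2"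
  proof -
    have "(\<Sum>i=3..k. b i / fact i * (of_nat i * (if i - 1 = 2 then 1 else 0))) =
        (\<Sum>i=3..k. if i = 3 then b 3 / 2 else 0)"
      by (intro sum.cong refl) (auto simp: fact_numeral)
    with k show ?thesis by simp
  qed
  ultimately show "((\<lambda>x. partial_deriv 2 W (p x) $ 2 / (v x)\<^sup>2) \<longlongrightarrow> c + b 3 / 2) F"
    by (simp only: tendsto_cong add_0_right)
qed

end

section \<open>The Darboux frame and its contour condition\<close>

lemma tendsto_vec_nth_unique:
  fixes X :: "real \<Rightarrow> real^'n"
  assumes "isCont X 0" "((\<lambda>x. X x $ i) \<longlongrightarrow> l) (at 0)"
  shows "X 0 $ i = l"
  using LIM_unique[OF tendsto_vec_nth[OF assms(1)[unfolded isCont_def]] assms(2)] .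

text \<open>The curve \<open>c_w m f\<close> follows the parabola \<open>u = f(0) v\<^sup>2\<close> in the sense of the previous section, with \<open>v = x\<^sup>m\<close>.\<close>
lemma c_w_quotient_tendsto:
  fixes f :: "real \<Rightarrow> real"
  assumes "smooth_germ f" "m \<ge> 1"
  shows "((\<lambda>x::real. x ^ m) \<longlongrightarrow> 0) (at 0)" "\<forall>\<^sub>F x::real in at 0. x ^ m \<noteq> 0"
    "((\<lambda>x. x ^ (2 * m) * f x / (x ^ m)\<^sup>2) \<longlongrightarrow> f 0) (at 0)"
proof -
  have "((\<lambda>x::real. x ^ m) \<longlongrightarrow> 0 ^ m) (at 0)" by (intro tendsto_intros)
  then show "((\<lambda>x::real. x ^ m) \<longlongrightarrow> 0) (at 0)" using assms(2) by (simp add: power_0_left)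
  show "\<forall>\<^sub>F x::real in at 0. x ^ m \<noteq> 0"
    using eventually_neq_at_within[of 0 0 UNIV] by eventually_elim simp
  have "x ^ (2 * m) = (x ^ m)\<^sup>2" for x :: real
    by (simp add: power_mult[symmetric] mult.commute)
  then have "\<forall>\<^sub>F x in at 0. x ^ (2 * m) * f x / (x ^ m)\<^sup>2 = f x"
    by (simp add: eventually_at_filter)
  then show "((\<lambda>x. x ^ (2 * m) * f x / (x ^ m)\<^sup>2) \<longlongrightarrow> f 0) (at 0)"
    using smooth_germ_isCont[OF assms(1)] by (simp add: isCont_def tendsto_cong)
qed

text \<open>The first component of \<open>W\<^sub>u \<times> W\<^sub>v\<close> is \<open>t \<cdot> a\<^sub>0\<^sub>2 t\<close> up to \<open>o(t\<^sup>2)\<close>, as the other product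
  pairs \<open>a\<^sub>1\<^sub>1 t\<close> with a term of order two.\<close>
lemma bruce_west_normal_along_c_w:
  assumes W: "bruce_west_normal_form k a b W" and m: "m \<ge> 1" and f: "smooth_germ f"
    and N: "smooth_germ N"
      "\<forall>\<^sub>F x in nhds 0. partial_deriv 1 W (c_w m f x) \<times> partial_deriv 2 W (c_w m f x) = x ^ m *\<^sub>R N x"
  shows "N 0 = vector [0, - a 0 2, 0]"
    and "((\<lambda>x. N x $ 1 / x ^ m) \<longlongrightarrow> a 0 2) (at 0)"
    and "((\<lambda>x. N x $ 3 / x ^ m) \<longlongrightarrow> f 0 + b 3 / 2) (at 0)"
proof -
  note c = c_w_quotient_tendsto[OF f m]
  note lim = bruce_west_along_curve[OF c W, folded c_w_def]
  have ev: "\<forall>\<^sub>F x in at 0. partial_deriv 1 W (c_w m f x) \<times> partial_deriv 2 W (c_w m f x) = x ^ m *\<^sub>R N x"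
    using N(2) by (simp add: eventually_nhds_conv_at)
  let ?X = "\<lambda>x. partial_deriv 1 W (c_w m f x)" and ?Y = "\<lambda>x. partial_deriv 2 W (c_w m f x)"
  have comp: "\<forall>\<^sub>F x in at 0. x \<noteq> 0 \<and> x ^ m * N x $ 1 = ?X x $ 2 * ?Y x $ 3 - ?X x $ 3 * ?Y x $ 2 \<and>
      x ^ m * N x $ 2 = - (?Y x $ 3) \<and> x ^ m * N x $ 3 = ?Y x $ 2"
    using ev lim(2,5) eventually_neq_at_within[of 0 0 UNIV]
  proof eventually_elim
    case (elim x)
    from elim(1)[symmetric] elim(2,3,4) show ?case
      by (simp add: cross3_def vec_eq_iff forall_3)
  qed

  have "\<forall>\<^sub>F x in at 0. N x $ 1 / x ^ m =
      (?X x $ 2 / x ^ m) * (?Y x $ 3 / x ^ m) - (?X x $ 3 / x ^ m) * (?Y x $ 2 / (x ^ m)\<^sup>2) * x ^ m"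
    using comp by eventually_elim (simp add: field_simps power2_eq_square)
  moreover have "((\<lambda>x. (?X x $ 2 / x ^ m) * (?Y x $ 3 / x ^ m)
      - (?X x $ 3 / x ^ m) * (?Y x $ 2 / (x ^ m)\<^sup>2) * x ^ m) \<longlongrightarrow> 1 * a 0 2 - a 1 1 * (f 0 + b 3 / 2) * 0) (at 0)"
    by (intro tendsto_intros lim c)
  ultimately show N1: "((\<lambda>x. N x $ 1 / x ^ m) \<longlongrightarrow> a 0 2) (at 0)" by (simp add: tendsto_cong)

  have "\<forall>\<^sub>F x in at 0. N x $ 3 / x ^ m = ?Y x $ 2 / (x ^ m)\<^sup>2"
    using comp by eventually_elim (simp add: field_simps power2_eq_square)
  with lim(6) show N3: "((\<lambda>x. N x $ 3 / x ^ m) \<longlongrightarrow> f 0 + b 3 / 2) (at 0)" by (simp add: tendsto_cong)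

  have "\<forall>\<^sub>F x in at 0. N x $ 2 = - (?Y x $ 3 / x ^ m)"
    using comp by eventually_elim (simp add: field_simps)
  with tendsto_minus[OF lim(7)] have N2: "((\<lambda>x. N x $ 2) \<longlongrightarrow> - a 0 2) (at 0)"
    by (simp add: tendsto_cong)

  note vanish = tendsto_0_if_quotient_tendsto[OF c(1,2)]
  show "N 0 = vector [0, - a 0 2, 0]"
    using tendsto_vec_nth_unique[OF smooth_germ_isCont[OF N(1)]] vanish[OF N1] N2 vanish[OF N3]
    by (simp add: vec_eq_iff forall_3)
qed

lemma c_w_has_vector_derivative:
  assumes "(f has_real_derivative f') (at x)" "m \<ge> 1"
  shows "(c_w m f has_vector_derivative
     (x ^ (2 * m - 1) *\<^sub>R ((of_nat (2 * m) * f x + x * f') *\<^sub>R axis 1 1) + (of_nat m * x ^ (m - 1)) *\<^sub>R axis 2 1)) (at x)"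
proof -
  have "c_w m f = (\<lambda>x. x ^ m *\<^sub>R axis 2 1 + (x ^ (2 * m) * f x) *\<^sub>R axis 1 1)"
    by (simp add: fun_eq_iff c_w_def vector_2_axis)
  moreover have "x ^ (2 * m) = x ^ (2 * m - 1) * x"
    using assms(2) power_minus_mult[of "2 * m" x] by simp
  moreover have "((\<lambda>x. x ^ m *\<^sub>R axis 2 1 + (x ^ (2 * m) * f x) *\<^sub>R axis 1 1 :: real^2) has_vector_derivative
     (of_nat m * x ^ (m - 1)) *\<^sub>R axis 2 1 + (of_nat (2 * m) * x ^ (2 * m - 1) * f x + f' * x ^ (2 * m)) *\<^sub>R axis 1 1) (at x)"
    unfolding has_vector_derivative_def
    using assms(1)[unfolded has_field_derivative_def]
    by (auto intro!: derivative_eq_intros simp: algebra_simps)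
  ultimately show ?thesis by (simp add: algebra_simps)
qed

text \<open>With \<open>u' = x\<^bsup>2m-1\<^esup> (2m f + x f')\<close> and \<open>v' = m x\<^bsup>m-1\<^esup> = m x\<^bsup>2m-1\<^esup> / x\<^sup>m\<close>, the chain rule gives
  \<open>E = (2m f + x f') W\<^sub>u + m W\<^sub>v / x\<^sup>m\<close> for \<open>x \<noteq> 0\<close>, and both summands converge.\<close>
lemma bruce_west_tangent_along_c_w:
  assumes W: "bruce_west_normal_form k a b W" and m: "m \<ge> 1" and f: "smooth_germ f"
    and E: "smooth_germ E"
      "\<forall>\<^sub>F x in nhds 0. vector_derivative (W \<circ> c_w m f) (at x) = x ^ (2 * m - 1) *\<^sub>R E x"
  shows "E 0 = of_nat m *\<^sub>R vector [2 * f 0, 0, a 0 2]"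
proof -
  note c = c_w_quotient_tendsto[OF f m]
  note lim = bruce_west_along_curve[OF c W, folded c_w_def]
  let ?X = "\<lambda>x. partial_deriv 1 W (c_w m f x)" and ?Y = "\<lambda>x. partial_deriv 2 W (c_w m f x)"
  let ?A = "\<lambda>x. of_nat (2 * m) * f x + x * deriv f x"
  have evs: "\<forall>\<^sub>F x in at 0. vector_derivative (W \<circ> c_w m f) (at x) = x ^ (2 * m - 1) *\<^sub>R E x"
    "\<forall>\<^sub>F x in at 0. (f has_real_derivative deriv f x) (at x)"
    using E(2) smooth_germ_has_real_derivative[OF f] by (simp_all add: eventually_nhds_conv_at)
  have E': "\<forall>\<^sub>F x in at 0. E x = ?A x *\<^sub>R ?X x + of_nat m *\<^sub>R (?Y x /\<^sub>R x ^ m)"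
    using evs lim(1) eventually_neq_at_within[of 0 0 UNIV]
  proof eventually_elim
    case (elim x)
    let ?D = "frechet_derivative W (at (c_w m f x))"
    have D: "(W has_derivative ?D) (at (c_w m f x))" using elim(3) by (simp add: frechet_derivative_works)
    have lin: "linear ?D" using D by (rule has_derivative_linear)
    have "2 * m - 1 = m + (m - 1)" using m by simp
    then have "x ^ (2 * m - 1) = x ^ m * x ^ (m - 1)" by (simp only: power_add)
    then have pow: "x ^ (m - 1) = x ^ (2 * m - 1) / x ^ m" using elim(4) by simp
    have "(W \<circ> c_w m f has_vector_derivative
        ?D (x ^ (2 * m - 1) *\<^sub>R (?A x *\<^sub>R axis 1 1) + (of_nat m * x ^ (m - 1)) *\<^sub>R axis 2 1)) (at x)"
      by (rule vector_derivative_diff_chain_within[of _ _ _ UNIV, simplified, OF c_w_has_vector_derivative[OF elim(2) m]])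
        (rule has_derivative_at_withinI[OF D])
    then have "x ^ (2 * m - 1) *\<^sub>R E x =
        ?D (x ^ (2 * m - 1) *\<^sub>R (?A x *\<^sub>R axis 1 1) + (of_nat m * x ^ (m - 1)) *\<^sub>R axis 2 1)"
      using elim(1) by (simp add: vector_derivative_at)
    also have "\<dots> = x ^ (2 * m - 1) *\<^sub>R (?A x *\<^sub>R ?X x + of_nat m *\<^sub>R (?Y x /\<^sub>R x ^ m))"
      unfolding pow linear_add[OF lin] linear_scale[OF lin] partial_deriv_def
      by (simp add: scaleR_add_right divide_inverse mult_ac)
    finally show ?case using elim(4) by simp
  qed
  have A: "(?A \<longlongrightarrow> of_nat (2 * m) * f 0 + 0 * deriv f 0) (at 0)"
    using smooth_germ_isCont[OF f] smooth_germ_isCont[OF smooth_germ_deriv[OF f]]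
    unfolding isCont_def by (intro tendsto_intros)
  have X1: "((\<lambda>x. ?X x $ 1) \<longlongrightarrow> 1) (at 0)" using lim(2) by (simp add: tendsto_cong)
  have Y1: "((\<lambda>x. ?Y x $ 1 / x ^ m) \<longlongrightarrow> 0) (at 0)"
    by (rule tendsto_eventually) (use lim(5) in \<open>auto elim: eventually_mono\<close>)
  note vanish = tendsto_0_if_quotient_tendsto[OF c(1,2)]
  have Y2: "((\<lambda>x. ?Y x $ 2 / x ^ m) \<longlongrightarrow> 0) (at 0)"
    by (rule vanish) (use lim(6) in \<open>simp add: power2_eq_square\<close>)
  have E_lim: "((\<lambda>x. E x $ i) \<longlongrightarrow> of_nat (2 * m) * f 0 * p + of_nat m * q) (at 0)"
    if "((\<lambda>x. ?X x $ i) \<longlongrightarrow> p) (at 0)" "((\<lambda>x. ?Y x $ i / x ^ m) \<longlongrightarrow> q) (at 0)" for i p q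
  proof -
    have "\<forall>\<^sub>F x in at 0. E x $ i = ?A x * ?X x $ i + of_nat m * (?Y x $ i / x ^ m)"
      using E' by eventually_elim (simp add: divide_inverse mult_ac)
    moreover have "((\<lambda>x. ?A x * ?X x $ i + of_nat m * (?Y x $ i / x ^ m)) \<longlongrightarrow>
        (of_nat (2 * m) * f 0 + 0 * deriv f 0) * p + of_nat m * q) (at 0)"
      by (intro tendsto_add[OF tendsto_mult[OF A that(1)] tendsto_mult[OF tendsto_const that(2)]])
    ultimately show ?thesis by (simp add: tendsto_cong)
  qed
  show ?thesis
    using tendsto_vec_nth_unique[OF smooth_germ_isCont[OF E(1)] E_lim[OF X1 Y1]]
      tendsto_vec_nth_unique[OF smooth_germ_isCont[OF E(1)] E_lim[OF vanish[OF lim(3)] Y2]]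
      tendsto_vec_nth_unique[OF smooth_germ_isCont[OF E(1)] E_lim[OF vanish[OF lim(4)] lim(7)]]
    by (simp add: vec_eq_iff forall_3)
qed

theorem theorem3p5:
  fixes W :: "real^2 \<Rightarrow> real^3"
    and a :: "nat \<Rightarrow> nat \<Rightarrow> real" and b c :: "nat \<Rightarrow> real"
    and f :: "real \<Rightarrow> real" and k m :: nat
    and e bn n :: "real \<Rightarrow> real^3"
  assumes "whitney_umbrella W"
    and "bruce_west_normal_form k a b W"
    and "m \<ge> 1"
    and "smooth_germ f" and "\<And>i. c i = taylor_coeff f i"
    and "darboux_frame W (c_w m f) m e bn n"
  shows "approx_contour_generator m W (c_w m f) m n (bn 0) \<longleftrightarrow>
           2 * (c 0)\<^sup>2 + b 3 * c 0 - (a 0 2)\<^sup>2 = 0"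
proof -
  note W = assms(2) and m = assms(3) and f = assms(4)
  have c0: "c 0 = f 0" using assms(5) by (simp add: taylor_coeff_def)
  from assms(6) have un: "unit_normal_along W (c_w m f) m n"
    and bn: "bn 0 = n 0 \<times> e 0"
    unfolding darboux_frame_def by (auto dest: eventually_nhds_x_imp_x)
  from un obtain N where N: "smooth_germ N" "N 0 \<noteq> 0"
    "\<forall>\<^sub>F x in nhds 0. partial_deriv 1 W (c_w m f x) \<times> partial_deriv 2 W (c_w m f x) = x ^ m *\<^sub>R N x"
    "\<forall>\<^sub>F x in nhds 0. n x = N x /\<^sub>R norm (N x)"
    unfolding unit_normal_along_def by blast
  from assms(6) obtain E where E: "smooth_germ E" "E 0 \<noteq> 0"
    "\<forall>\<^sub>F x in nhds 0. vector_derivative (W \<circ> c_w m f) (at x) = x ^ (2 * m - 1) *\<^sub>R E x"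
    "\<forall>\<^sub>F x in nhds 0. e x = E x /\<^sub>R norm (E x)"
    unfolding darboux_frame_def unit_tangent_along_def by blast
  note N_lim = bruce_west_normal_along_c_w[OF W m f N(1,3)]
  note E0 = bruce_west_tangent_along_c_w[OF W m f E(1,3)]
  \<comment> \<open>The factor by which \<open>b(0)\<close> differs from \<open>(a\<^sub>0\<^sub>2, 0, - 2 c\<^sub>0)\<close>.\<close>
  define \<beta> where "\<beta> = - (a 0 2 * of_nat m / (norm (N 0) * norm (E 0)))"
  have \<beta>: "\<beta> \<noteq> 0" using W m N(2) E(2) by (simp add: \<beta>_def bruce_west_normal_form_def)
  have n0: "n 0 = N 0 /\<^sub>R norm (N 0)" "e 0 = E 0 /\<^sub>R norm (E 0)"
    using N(4) E(4) by (auto dest: eventually_nhds_x_imp_x)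
  have "N 0 \<times> E 0 = (- (a 0 2 * of_nat m)) *\<^sub>R vector [a 0 2, 0, - 2 * f 0]"
    unfolding N_lim(1) E0 by (simp add: cross3_def vec_eq_iff forall_3)
  then have w: "bn 0 = \<beta> *\<^sub>R vector [a 0 2, 0, - 2 * f 0]"
    unfolding bn n0 by (simp add: cross_mult_left cross_mult_right \<beta>_def divide_inverse mult_ac)

  have "smooth_germ (\<lambda>x. n x \<bullet> bn 0)"
    by (rule smooth_germ_cong[OF smooth_germ_unit_normal_component[OF N(1,2)]])
      (use N(4) in \<open>auto elim: eventually_mono\<close>)
  moreover have "((\<lambda>x. (n x \<bullet> bn 0) / x ^ m) \<longlongrightarrow>
      \<beta> / norm (N 0) * (a 0 2 * a 0 2 - 2 * f 0 * (f 0 + b 3 / 2))) (at 0)"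
  proof -
    have "\<forall>\<^sub>F x in at 0. n x = N x /\<^sub>R norm (N x)"
      using N(4) by (simp add: eventually_nhds_conv_at)
    then have "\<forall>\<^sub>F x in at 0. (n x \<bullet> bn 0) / x ^ m =
        \<beta> / norm (N x) * (a 0 2 * (N x $ 1 / x ^ m) - 2 * f 0 * (N x $ 3 / x ^ m))"
      by eventually_elim (simp add: w inner_vec_def sum_3 divide_inverse algebra_simps)
    moreover have "((\<lambda>x. \<beta> / norm (N x) * (a 0 2 * (N x $ 1 / x ^ m) - 2 * f 0 * (N x $ 3 / x ^ m))) \<longlongrightarrow>
        \<beta> / norm (N 0) * (a 0 2 * a 0 2 - 2 * f 0 * (f 0 + b 3 / 2))) (at 0)"
      using smooth_germ_isCont[OF N(1)] N(2) unfolding isCont_def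
      by (intro tendsto_intros N_lim) auto
    ultimately show ?thesis by (simp add: tendsto_cong)
  qed
  ultimately have "(\<forall>j\<le>m. taylor_coeff (\<lambda>x. n x \<bullet> bn 0) j = 0) \<longleftrightarrow>
      \<beta> / norm (N 0) * (a 0 2 * a 0 2 - 2 * f 0 * (f 0 + b 3 / 2)) = 0"
    by (rule taylor_coeffs_vanish_iff)
  also have "\<dots> \<longleftrightarrow> a 0 2 * a 0 2 - 2 * f 0 * (f 0 + b 3 / 2) = 0"
    using \<beta> N(2) by simp
  also have "\<dots> \<longleftrightarrow> 2 * (c 0)\<^sup>2 + b 3 * c 0 - (a 0 2)\<^sup>2 = 0"
    unfolding c0 by (simp add: power2_eq_square algebra_simps) linarith
  finally show ?thesis using un by (simp add: approx_contour_generator_def)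
qed

end
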